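(* Let $\alpha>0$, $q\in\mathbb N$ with $2q-1<\alpha<2q+1$, $p\in\mathbb N$ and, for $h>0$ and $k\in\mathbb R$, $$\psi^p_h(k)=(-1)^{q+1}h^{-\alpha}e^{-iphk}(1-e^{ikh})^\alpha .$$ Then: (a) There are constants $C,C'>0$ independent of $h$ such that for every $h>0$ and $0<|k|<\pi/h$: $|\psi^p_h(k)|\le C|k|^\alpha$ and $\left|\frac{d}{dk}\psi^p_h(k)\right|\le C'|k|^{\alpha-1}$. (b) The following are equivalent: $\operatorname{Re}(\psi^p_h)$ does not change sign on $\mathbb R$; $\left|p-\frac\alpha2\right|<\frac12$; there is $c>0$ independent of $h$ such that $\operatorname{Re}(\psi^p_h(k))\le -c|k|^\alpha$ for all $h>0$ and $|k|\le\pi/h$.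
   Context: $\mathbb N$ includes $0$. Complex powers are principal (branch cut along the negative real axis), with $0^\alpha=0$. The function $\psi^p_h$ is $2\pi/h$-periodic when $p\in\mathbb N$, and $\psi^p_h(k)=h^{-\alpha}\psi^p_1(hk)$. "Does not change sign" means that the real-valued function does not take both strictly positive and strictly negative values. *)

theory Defs
  imports "HOL-Complex_Analysis.Complex_Analysis"
begin

text \<open>The complex \<^const>\<open>powr\<close> is the principal power \<open>exp (\<alpha> * Ln z)\<close>, with \<open>0 powr \<alpha> = 0\<close>.\<close>

definition psi :: "real \<Rightarrow> nat \<Rightarrow> nat \<Rightarrow> real \<Rightarrow> real \<Rightarrow> complex" where
  "psi \<alpha> q p h k =
     (-1) ^ (q + 1) * complex_of_real (h powr (-\<alpha>))
       * exp (- \<i> * of_nat p * of_real h * of_real k)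
       * (1 - exp (\<i> * of_real k * of_real h)) powr (complex_of_real \<alpha>)"

definition changes_sign :: "(real \<Rightarrow> real) \<Rightarrow> bool" where
  "changes_sign f \<longleftrightarrow> (\<exists>x. f x > 0) \<and> (\<exists>y. f y < 0)"

end

theory Submission
  imports Defs
begin

text \<open>
  Everything follows from the polar form of the chord \<open>1 - cis \<theta>\<close>. For \<open>0 < \<theta> < 2\<pi>\<close> it has length
  \<open>2 sin (\<theta>/2)\<close> and argument \<open>(\<theta> - \<pi>)/2\<close>, and this argument lies in \<open>(-\<pi>/2, \<pi>/2)\<close>, so that the principal
  power simply multiplies it by \<open>\<alpha>\<close>. Writing \<open>\<theta>\<close> for the representative of \<open>h k\<close> modulo \<open>2\<pi>\<close>, the phase of
  \<open>cis (-p\<theta>) (1 - cis \<theta>) powr \<alpha>\<close> is \<open>(\<alpha>/2 - p)(\<theta> - \<pi>) - p\<pi>\<close>, hence (\<open>Re_psi\<close>) the real part of the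
  symbol is \<open>cos ((\<alpha>/2 - p)(\<theta> - \<pi>))\<close> times the positive amplitude \<open>(2 sin (\<theta>/2) / h) powr \<alpha>\<close> times the
  constant sign \<open>(-1) ^ (q + 1 + p)\<close>.

  Only the cosine can change sign. As \<open>\<theta>\<close> runs through \<open>(0, 2\<pi>)\<close> its argument fills the symmetric open
  interval of radius \<open>\<bar>\<alpha>/2 - p\<bar>\<pi>\<close>, so the cosine is positive if this radius is at most \<open>\<pi>/2\<close> and takes
  both signs otherwise. Since \<open>\<alpha>/2\<close> is at distance less than \<open>1/2\<close> from the integer \<open>q\<close>, the
  radius is less than \<open>\<pi>/2\<close> for \<open>p = q\<close> and greater than \<open>\<pi>/2\<close> for every other \<open>p\<close>. In the first case the
  sign factor is \<open>-1\<close> and the cosine is bounded below by \<open>cos ((\<alpha>/2 - p)\<pi>) > 0\<close>, which with Jordan's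
  inequality gives the coercive bound (\<open>Re_psi_coercive\<close>); in the second both signs already occur for
  \<open>0 < k \<le> \<pi>/h\<close> (\<open>Re_psi_both_signs\<close>), which refutes both other conditions.

  The bounds on the symbol and its derivative come from the fact that \<open>\<bar>1 - cis (h k)\<bar>\<close> is comparable
  with \<open>h \<bar>k\<bar>\<close> as long as \<open>h \<bar>k\<bar> \<le> \<pi>\<close>. The upper comparison suffices for the symbol; for the derivative,
  which carries the power \<open>\<alpha> - 1\<close>, the lower one is needed when \<open>\<alpha> < 1\<close>. The powers of \<open>h\<close> cancel by
  homogeneity.
\<close>

section \<open>The chord of the unit circle\<close>

lemma cmod_one_minus_cis: "cmod (1 - cis t) = 2 * \<bar>sin (t / 2)\<bar>"
  using dist_exp_i_1[of t] by (simp add: cis_conv_exp norm_minus_commute)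

text \<open>Jordan's inequality: the sine is concave on \<open>[0, \<pi>/2]\<close>, so its graph lies above the secant.\<close>

lemma Jordan_sin_ge:
  fixes x :: real
  assumes "0 \<le> x" "x \<le> pi / 2"
  shows "2 / pi * x \<le> sin x"
proof -
  have "convex_on {0..pi/2} (\<lambda>x. - sin x :: real)"
  proof (rule f''_ge0_imp_convex[where f' = "\<lambda>x. - cos x" and f'' = sin])
    show "((\<lambda>x. - sin x) has_real_derivative - cos x) (at x)" for x :: real
      by (auto intro!: derivative_eq_intros)
    show "((\<lambda>x. - cos x) has_real_derivative sin x) (at x)" for x :: real
      by (auto intro!: derivative_eq_intros)
    show "0 \<le> sin x" if "x \<in> {0..pi/2}" for x :: real
      using that pi_gt_zero by (intro sin_ge_zero) auto
  qed auto
  from convex_onD[OF this, of "2 / pi * x" 0 "pi / 2"] assms show ?thesis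
    by (auto simp: field_simps)
qed

lemma chord_le: "cmod (1 - cis t) \<le> \<bar>t\<bar>"
  using abs_sin_x_le_abs_x[of "t / 2"] by (simp add: cmod_one_minus_cis)

lemma chord_ge:
  assumes "\<bar>t\<bar> \<le> pi"
  shows "2 / pi * \<bar>t\<bar> \<le> cmod (1 - cis t)"
proof -
  have "2 / pi * (\<bar>t\<bar> / 2) \<le> sin (\<bar>t\<bar> / 2)"
    using assms by (intro Jordan_sin_ge) auto
  also have "\<dots> \<le> \<bar>sin (t / 2)\<bar>"
    by (cases "t \<ge> 0") (auto simp: abs_if)
  finally show ?thesis
    by (simp add: cmod_one_minus_cis)
qed

lemma one_minus_cis_polar:
  "1 - cis t = rcis (2 * sin (t / 2)) ((t - pi) / 2)"
proof (rule complex_eqI)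
  have "cos ((t - pi) / 2) = sin (t / 2)" "sin ((t - pi) / 2) = - cos (t / 2)"
    by (simp_all add: diff_divide_distrib cos_diff sin_diff)
  then show "Re (1 - cis t) = Re (rcis (2 * sin (t / 2)) ((t - pi) / 2))"
    and "Im (1 - cis t) = Im (rcis (2 * sin (t / 2)) ((t - pi) / 2))"
    using cos_double_sin[of "t / 2"] sin_double[of "t / 2"]
    by (simp_all add: power2_eq_square)
qed

lemma rcis_powr_of_real:
  assumes "r > 0" "- pi < a" "a \<le> pi"
  shows "rcis r a powr of_real x = rcis (r powr x) (x * a)"
proof -
  have "Ln (rcis r a) = of_real (ln r) + \<i> * of_real a"
    using assms by (intro Ln_unique) (auto simp: rcis_def cis_conv_exp exp_add exp_of_real)
  then show ?thesis
    using assms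
    by (simp add: powr_def rcis_def cis_conv_exp exp_add exp_of_real algebra_simps)
       (simp flip: exp_of_real exp_add add: algebra_simps)
qed

section \<open>The real part of the symbol\<close>

lemma psi_eq_cis:
  "psi \<alpha> q p h k = (-1) ^ (q + 1) * of_real (h powr (-\<alpha>))
     * cis (- (real p * (h * k))) * (1 - cis (h * k)) powr of_real \<alpha>"
  by (simp add: psi_def cis_conv_exp mult_ac)

text \<open>The shift by \<open>2\<pi>n\<close> covers the periodicity in \<open>k\<close>; with \<open>n = -1\<close> it also reduces negative \<open>k\<close>
  to the interval \<open>(0, 2\<pi>)\<close> on which the polar form of the chord holds.\<close>

lemma Re_psi:
  assumes "0 < \<theta>" "\<theta> < 2 * pi" and shift: "h * k = \<theta> + 2 * pi * of_int n"
  shows "Re (psi \<alpha> q p h k) =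
    (-1) ^ (q + 1 + p) * (h powr (-\<alpha>) * (2 * sin (\<theta> / 2)) powr \<alpha>
      * cos ((\<alpha> / 2 - real p) * (\<theta> - pi)))"
proof -
  have "sin (\<theta> / 2) > 0"
    using assms by (intro sin_gt_zero) auto
  then have pow: "(1 - cis \<theta>) powr of_real \<alpha> = rcis ((2 * sin (\<theta> / 2)) powr \<alpha>) (\<alpha> * ((\<theta> - pi) / 2))"
    using assms by (subst one_minus_cis_polar, intro rcis_powr_of_real) auto
  have cis_shift: "cis (h * k) = cis \<theta>"
    by (simp add: shift flip: cis_mult)
  have "cis (- (real p * (h * k))) = cis (- (h * k)) ^ p"
    by (simp add: Complex.DeMoivre)
  also have "cis (- (h * k)) = cis (- \<theta>)"
    using cis_shift by (metis cis_cnj)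
  also have "\<dots> ^ p = cis (- (real p * \<theta>))"
    by (simp add: Complex.DeMoivre)
  finally have "psi \<alpha> q p h k = (-1) ^ (q + 1) * of_real (h powr (-\<alpha>) * (2 * sin (\<theta> / 2)) powr \<alpha>)
      * (cis (- (real p * \<theta>)) * cis (\<alpha> * ((\<theta> - pi) / 2)))"
    by (simp add: psi_eq_cis cis_shift pow rcis_def)
  also have "cis (- (real p * \<theta>)) * cis (\<alpha> * ((\<theta> - pi) / 2))
      = cis ((\<alpha> / 2 - real p) * (\<theta> - pi)) * cis (- pi) ^ p"
    by (simp only: cis_mult Complex.DeMoivre) (simp add: algebra_simps diff_divide_distrib)
  also have "cis (- pi) = -1"
    by (simp add: complex_eq_iff)
  finally have "psi \<alpha> q p h k = of_real ((-1) ^ (q + 1 + p) * (h powr (-\<alpha>) * (2 * sin (\<theta> / 2)) powr \<alpha>))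
      * cis ((\<alpha> / 2 - real p) * (\<theta> - pi))"
    by (simp add: power_add mult_ac)
  then show ?thesis
    by (simp only: times_complex.sel Re_complex_of_real Im_complex_of_real cis.sel)
qed

section \<open>Boundedness of the symbol and its derivative\<close>

lemma cmod_psi_le:
  assumes "\<alpha> > 0" "h > 0"
  shows "cmod (psi \<alpha> q p h k) \<le> \<bar>k\<bar> powr \<alpha>"
proof -
  have "cmod (psi \<alpha> q p h k) = h powr (-\<alpha>) * cmod (1 - cis (h * k)) powr \<alpha>"
    by (simp add: psi_eq_cis norm_mult norm_power norm_powr_real_powr')
  also have "\<dots> \<le> h powr (-\<alpha>) * \<bar>h * k\<bar> powr \<alpha>"
    using assms by (intro mult_left_mono powr_mono2 chord_le) auto
  also have "\<dots> = \<bar>k\<bar> powr \<alpha>"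
    using assms by (simp add: abs_mult powr_mult powr_minus)
  finally show ?thesis .
qed

text \<open>Away from the zeros of the chord its real part \<open>1 - cos (h k)\<close> is positive, so the base of the
  power stays off the branch cut and the chain rule applies.\<close>

lemma psi_has_vector_derivative:
  assumes "cis (h * k) \<noteq> 1"
  shows "(psi \<alpha> q p h has_vector_derivative
     (-1) ^ (q + 1) * of_real (h powr (-\<alpha>)) *
       (- \<i> * of_nat p * of_real h * cis (- (real p * (h * k))) * (1 - cis (h * k)) powr of_real \<alpha>
        - cis (- (real p * (h * k))) * (of_real \<alpha> * (1 - cis (h * k)) powr of_real (\<alpha> - 1))
            * (\<i> * of_real h * cis (h * k)))) (at k)"
proof -
  have "Re (cis (h * k)) < 1"
  proof (rule ccontr)
    assume "\<not> Re (cis (h * k)) < 1"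
    then have c: "cos (h * k) = 1"
      using cos_le_one[of "h * k"] by simp
    moreover from c have "sin (h * k) = 0"
      using sin_cos_squared_add[of "h * k"] by simp
    ultimately show False
      using assms by (simp add: complex_eq_iff)
  qed
  then have "1 - cis (h * k) \<notin> \<real>\<^sub>\<le>\<^sub>0"
    by (auto simp: complex_nonpos_Reals_iff)
  then have nonpos: "1 - exp (\<i> * of_real k * of_real h) \<notin> \<real>\<^sub>\<le>\<^sub>0"
    by (simp add: cis_conv_exp mult_ac)
  let ?c = "(-1) ^ (q + 1) * complex_of_real (h powr (-\<alpha>))"
  let ?e = "exp (- \<i> * of_nat p * of_real h * of_real k)"
  let ?z = "exp (\<i> * of_real k * of_real h)"
  have "((\<lambda>z. 1 - exp (\<i> * z * of_real h)) has_field_derivative - (\<i> * of_real h * ?z)) (at (of_real k))"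
    by (auto intro!: derivative_eq_intros)
  from DERIV_chain2[OF has_field_derivative_powr[OF nonpos] this, of "of_real \<alpha>"]
  have pow: "((\<lambda>z. (1 - exp (\<i> * z * of_real h)) powr of_real \<alpha>) has_field_derivative
      of_real \<alpha> * (1 - ?z) powr (of_real \<alpha> - 1) * - (\<i> * of_real h * ?z)) (at (of_real k))" .
  have "((\<lambda>z. exp (- \<i> * of_nat p * of_real h * z)) has_field_derivative
      - \<i> * of_nat p * of_real h * ?e) (at (of_real k))"
    by (auto intro!: derivative_eq_intros)
  note DERIV_cmult[OF DERIV_mult[OF this pow], of ?c]
  from has_vector_derivative_real_field[OF this]
  have der: "(psi \<alpha> q p h has_vector_derivative
      ?c * (- \<i> * of_nat p * of_real h * ?e * (1 - ?z) powr of_real \<alpha>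
        + of_real \<alpha> * (1 - ?z) powr (of_real \<alpha> - 1) * - (\<i> * of_real h * ?z) * ?e)) (at k)"
    by (simp only: psi_def[abs_def] mult.assoc)
  have "?e = cis (- (real p * (h * k)))" "?z = cis (h * k)"
    by (simp_all add: cis_conv_exp mult_ac)
  with der show ?thesis
    by (simp only: of_real_diff of_real_add of_real_minus of_real_1 diff_conv_add_uminus mult_minus_left mult_minus_right mult_ac)
qed

text \<open>The factor \<open>1 + (2/\<pi>)\<^sup>s\<close> treats both signs of the exponent at once: the upper bound on the chord
  gives the constant \<open>1\<close> for \<open>s \<ge> 0\<close>, and the lower bound gives \<open>(2/\<pi>)\<^sup>s\<close> for \<open>s < 0\<close>.\<close>

lemma chord_powr_le:
  assumes "t \<noteq> 0" "\<bar>t\<bar> \<le> pi"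
  shows "cmod (1 - cis t) powr s \<le> (1 + (2 / pi) powr s) * \<bar>t\<bar> powr s"
proof (cases "s \<ge> 0")
  case True
  then have "cmod (1 - cis t) powr s \<le> \<bar>t\<bar> powr s"
    by (intro powr_mono2 chord_le) auto
  then show ?thesis
    by (simp add: distrib_right add_increasing2)
next
  case False
  then have "cmod (1 - cis t) powr s \<le> (2 / pi * \<bar>t\<bar>) powr s"
    using assms by (intro powr_mono2' chord_ge) auto
  also have "\<dots> = (2 / pi) powr s * \<bar>t\<bar> powr s"
    by (rule powr_mult)
  finally show ?thesis
    by (simp add: distrib_right add_increasing)
qed

lemma psi_derivative_bound:
  assumes "\<alpha> > 0" "h > 0" "k \<noteq> 0" "\<bar>k\<bar> < pi / h"
  shows "psi \<alpha> q p h differentiable (at k)"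
    and "cmod (vector_derivative (psi \<alpha> q p h) (at k))
      \<le> (2 * real p + \<alpha>) * (1 + (2 / pi) powr (\<alpha> - 1)) * \<bar>k\<bar> powr (\<alpha> - 1)"
proof -
  define s where "s = cmod (1 - cis (h * k))"
  have hk: "h * k \<noteq> 0" "\<bar>h * k\<bar> \<le> pi"
    using assms by (auto simp: abs_mult field_simps)
  have "2 / pi * \<bar>h * k\<bar> > 0"
    using hk by simp
  then have "s > 0"
    using chord_ge[OF hk(2)] unfolding s_def by linarith
  then have ne: "cis (h * k) \<noteq> 1"
    by (auto simp: s_def)
  note der = psi_has_vector_derivative[OF ne, of \<alpha> q p]
  then show "psi \<alpha> q p h differentiable (at k)"
    by (rule differentiableI_vector)
  have "s \<le> 2"
    unfolding s_def using norm_triangle_ineq4[of 1 "cis (h * k)"] by simp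
  have "cmod (vector_derivative (psi \<alpha> q p h) (at k))
      = h powr (-\<alpha>) * cmod (- \<i> * of_nat p * of_real h * cis (- (real p * (h * k))) * (1 - cis (h * k)) powr of_real \<alpha>
        - cis (- (real p * (h * k))) * (of_real \<alpha> * (1 - cis (h * k)) powr of_real (\<alpha> - 1))
            * (\<i> * of_real h * cis (h * k)))"
    by (subst vector_derivative_at[OF der]) (simp only: norm_mult norm_power norm_of_real norm_minus_cancel norm_one, simp)
  also have "\<dots> \<le> h powr (-\<alpha>) * (real p * h * s powr \<alpha> + \<alpha> * s powr (\<alpha> - 1) * h)"
    using assms
    by (intro mult_left_mono order.trans[OF norm_triangle_ineq4])
       (simp_all add: norm_mult norm_powr_real_powr' s_def del: of_real_diff)
  also have "s powr \<alpha> = s * s powr (\<alpha> - 1)"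
    using \<open>s > 0\<close> powr_mult_base[of s "\<alpha> - 1"] by simp
  also have "h powr (-\<alpha>) * (real p * h * (s * s powr (\<alpha> - 1)) + \<alpha> * s powr (\<alpha> - 1) * h)
      = (real p * s + \<alpha>) * (h powr (1 - \<alpha>) * s powr (\<alpha> - 1))"
    using assms powr_mult_base[of h "-\<alpha>", symmetric] by (simp add: algebra_simps)
  also have "\<dots> \<le> (2 * real p + \<alpha>) * (h powr (1 - \<alpha>) * ((1 + (2 / pi) powr (\<alpha> - 1)) * \<bar>h * k\<bar> powr (\<alpha> - 1)))"
    using assms \<open>s \<le> 2\<close> \<open>s > 0\<close> chord_powr_le[OF hk, of "\<alpha> - 1"] mult_left_mono[of s 2 "real p"]
    by (intro mult_mono mult_left_mono) (auto simp: s_def algebra_simps)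
  also have "\<dots> = (2 * real p + \<alpha>) * (1 + (2 / pi) powr (\<alpha> - 1)) * (h powr (1 - \<alpha>) * h powr (\<alpha> - 1)) * \<bar>k\<bar> powr (\<alpha> - 1)"
    using assms by (simp add: abs_mult powr_mult)
  also have "h powr (1 - \<alpha>) * h powr (\<alpha> - 1) = 1"
    using assms by (simp flip: powr_add)
  finally show "cmod (vector_derivative (psi \<alpha> q p h) (at k))
      \<le> (2 * real p + \<alpha>) * (1 + (2 / pi) powr (\<alpha> - 1)) * \<bar>k\<bar> powr (\<alpha> - 1)"
    by simp
qed

section \<open>The sign of the real part\<close>

lemma cos_scaled_pos:
  fixes w t :: real
  assumes "\<bar>w\<bar> < 1 / 2" "\<bar>t\<bar> \<le> pi"
  shows "0 < cos (w * pi)" "cos (w * pi) \<le> cos (w * t)"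
proof -
  have le: "\<bar>w * t\<bar> \<le> \<bar>w * pi\<bar>"
    using assms by (simp add: abs_mult mult_left_mono)
  have lt: "\<bar>w * pi\<bar> < pi / 2"
    using mult_strict_right_mono[OF assms(1) pi_gt_zero] by (simp only: abs_mult abs_of_pos pi_gt_zero)
  show "0 < cos (w * pi)"
    using lt by (intro cos_gt_zero_pi) linarith+
  have "cos \<bar>w * pi\<bar> \<le> cos \<bar>w * t\<bar>"
    using le lt by (intro cos_monotone_0_pi_le) auto
  then show "cos (w * pi) \<le> cos (w * t)"
    by simp
qed

lemma Re_psi_nonpos:
  assumes "\<bar>real q - \<alpha> / 2\<bar> < 1 / 2"
  shows "Re (psi \<alpha> q q h k) \<le> 0"
proof -
  define n where "n = \<lfloor>h * k / (2 * pi)\<rfloor>"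
  define \<theta> where "\<theta> = h * k - 2 * pi * of_int n"
  have "of_int n \<le> h * k / (2 * pi)" "h * k / (2 * pi) < of_int n + 1"
    unfolding n_def by linarith+
  then have range: "0 \<le> \<theta>" "\<theta> < 2 * pi"
    by (simp_all add: \<theta>_def field_simps)
  have shift: "h * k = \<theta> + 2 * pi * of_int n"
    by (simp add: \<theta>_def)
  show ?thesis
  proof (cases "\<theta> = 0")
    case True
    then have "cis (h * k) = 1"
      by (simp add: shift)
    then show ?thesis
      by (simp add: psi_eq_cis)
  next
    case False
    have "\<bar>\<alpha> / 2 - real q\<bar> < 1 / 2" "\<bar>\<theta> - pi\<bar> \<le> pi"
      using assms range by linarith+
    from cos_scaled_pos[OF this] have "cos ((\<alpha> / 2 - real q) * (\<theta> - pi)) > 0"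
      by linarith
    then show ?thesis
      using False range Re_psi[of \<theta> h k n \<alpha> q q] shift
      by (simp flip: mult_2 add: power_mult)
  qed
qed

lemma Re_psi_coercive:
  assumes "\<alpha> > 0" and "\<bar>real q - \<alpha> / 2\<bar> < 1 / 2" and "h > 0" and "\<bar>k\<bar> \<le> pi / h"
  shows "Re (psi \<alpha> q q h k) \<le> - ((2 / pi) powr \<alpha> * cos ((\<alpha> / 2 - real q) * pi)) * \<bar>k\<bar> powr \<alpha>"
proof (cases "k = 0")
  case True
  then show ?thesis
    by (simp add: psi_def)
next
  case False
  define w where "w = \<alpha> / 2 - real q"
  define t where "t = \<bar>h * k\<bar>"
  have w: "\<bar>w\<bar> < 1 / 2"
    using assms by (simp add: w_def abs_minus_commute)
  have t: "0 < t" "t \<le> pi"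
    using assms False by (auto simp: t_def abs_mult field_simps)
  have sign: "(-1 :: real) ^ (q + 1 + q) = -1"
    by simp
  have Re_eq: "Re (psi \<alpha> q q h k) = - (h powr (-\<alpha>) * (2 * sin (t / 2)) powr \<alpha> * cos (w * (t - pi)))"
  proof (cases "k > 0")
    case True
    then have "h * k = t + 2 * pi * of_int 0"
      using assms by (simp add: t_def)
    from Re_psi[OF _ _ this, of \<alpha> q q] show ?thesis
      using t sign by (simp add: w_def)
  next
    case False
    \<comment> \<open>Here \<open>h k = -t\<close>, and the formula is invariant under the reflection \<open>t \<mapsto> 2\<pi> - t\<close>.\<close>
    have "h * k = (2 * pi - t) + 2 * pi * of_int (- 1)"
      using assms False by (simp add: t_def abs_mult)
    from Re_psi[OF _ _ this, of \<alpha> q q]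
    have "Re (psi \<alpha> q q h k) = - (h powr (-\<alpha>) * (2 * sin ((2 * pi - t) / 2)) powr \<alpha> * cos (w * (2 * pi - t - pi)))"
      using t sign by (simp add: w_def)
    also have "sin ((2 * pi - t) / 2) = sin (t / 2)"
      by (simp add: diff_divide_distrib)
    also have "w * (2 * pi - t - pi) = - (w * (t - pi))"
      by (simp add: algebra_simps)
    finally show ?thesis
      by simp
  qed
  have "2 / pi * t \<le> 2 * sin (t / 2)"
    using t Jordan_sin_ge[of "t / 2"] by simp
  then have lower: "h powr (-\<alpha>) * (2 / pi * t) powr \<alpha> * cos (w * pi)
      \<le> h powr (-\<alpha>) * (2 * sin (t / 2)) powr \<alpha> * cos (w * (t - pi))"
    using t assms w cos_scaled_pos[of w "t - pi"]
    by (intro mult_mono[of "_ * _"] mult_left_mono powr_mono2) auto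
  have scale: "h powr (-\<alpha>) * (2 / pi * t) powr \<alpha> = (2 / pi) powr \<alpha> * \<bar>k\<bar> powr \<alpha>"
    using assms by (simp add: t_def abs_mult powr_mult powr_minus powr_divide)
  show ?thesis
    using lower unfolding scale Re_eq w_def by (simp add: mult_ac)
qed

lemma cos_scaled_neg:
  fixes w :: real
  assumes "\<bar>w\<bar> > 1 / 2"
  obtains t where "0 < t" "t < pi" "cos (w * t) < 0"
proof -
  \<comment> \<open>The scaled angle \<open>\<bar>w\<bar> t = v \<pi>\<close> is placed in \<open>(\<pi>/2, \<pi>]\<close>; \<open>v < \<bar>w\<bar>\<close> keeps \<open>t\<close> below \<open>\<pi>\<close>.\<close>
  define v where "v = min ((\<bar>w\<bar> + 1 / 2) / 2) 1"
  have v: "1 / 2 < v" "v < \<bar>w\<bar>" "v \<le> 1"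
    using assms by (auto simp: v_def min_def)
  define t where "t = v * pi / \<bar>w\<bar>"
  have "cos (w * t) = cos (v * pi)"
    using v by (cases "w \<ge> 0") (auto simp: t_def)
  also have "\<dots> = - cos (pi - v * pi)"
    by simp
  also have "\<dots> < 0"
  proof -
    have "pi / 2 < v * pi" "v * pi \<le> pi"
      using v by auto
    then show ?thesis
      using cos_gt_zero_pi[of "pi - v * pi"] by linarith
  qed
  finally have "cos (w * t) < 0" .
  moreover have "0 < t" "t < pi"
    using v by (auto simp: t_def field_simps)
  ultimately show thesis
    using that by blast
qed

text \<open>At \<open>h k = \<pi>\<close> the cosine equals \<open>1\<close>, and it is negative somewhere on \<open>(0, \<pi>)\<close>; the unknown parity
  of \<open>q + 1 + p\<close> only decides which of the two points carries which sign.\<close>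

lemma Re_psi_both_signs:
  assumes "h > 0" and "\<bar>real p - \<alpha> / 2\<bar> > 1 / 2"
  obtains k l where "0 < k" "k \<le> pi / h" "Re (psi \<alpha> q p h k) > 0"
    and "0 < l" "l \<le> pi / h" "Re (psi \<alpha> q p h l) < 0"
proof -
  define w where "w = \<alpha> / 2 - real p"
  define A where "A = (\<lambda>\<theta>. h powr (-\<alpha>) * (2 * sin (\<theta> / 2)) powr \<alpha>)"
  have Re_A: "Re (psi \<alpha> q p h (\<theta> / h)) = (-1) ^ (q + 1 + p) * (A \<theta> * cos (w * (\<theta> - pi)))"
    and A_pos: "A \<theta> > 0" if "0 < \<theta>" "\<theta> < 2 * pi" for \<theta>
  proof -
    have "sin (\<theta> / 2) > 0"
      using that by (intro sin_gt_zero) auto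
    then show "A \<theta> > 0"
      using assms by (simp add: A_def)
    show "Re (psi \<alpha> q p h (\<theta> / h)) = (-1) ^ (q + 1 + p) * (A \<theta> * cos (w * (\<theta> - pi)))"
      using Re_psi[OF that, of h "\<theta> / h" 0 \<alpha> q p] assms by (simp add: A_def w_def)
  qed
  have "\<bar>w\<bar> > 1 / 2"
    using assms by (simp add: w_def abs_minus_commute)
  then obtain t where t: "0 < t" "t < pi" "cos (w * t) < 0"
    by (rule cos_scaled_neg)
  have "w * (pi - t - pi) = - (w * t)"
    by simp
  then have cos_neg: "cos (w * (pi - t - pi)) < 0"
    using t by (metis cos_minus)
  have neg: "A (pi - t) * cos (w * (pi - t - pi)) < 0"
    using t by (intro mult_pos_neg A_pos cos_neg) auto
  have pos: "A pi * cos (w * (pi - pi)) > 0"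
    using A_pos[of pi] by simp
  have bounds: "0 < pi / h" "pi / h \<le> pi / h" "0 < (pi - t) / h" "(pi - t) / h \<le> pi / h"
    using assms t by (auto simp: divide_right_mono)
  show thesis
  proof (cases "even (q + 1 + p)")
    case True
    then have "Re (psi \<alpha> q p h (pi / h)) > 0" "Re (psi \<alpha> q p h ((pi - t) / h)) < 0"
      using Re_A[of pi] Re_A[of "pi - t"] t pos neg by (simp_all del: add_diff_cancel_left' diff_self)
    with bounds show thesis
      using that by blast
  next
    case False
    then have "Re (psi \<alpha> q p h ((pi - t) / h)) > 0" "Re (psi \<alpha> q p h (pi / h)) < 0"
      using Re_A[of pi] Re_A[of "pi - t"] t pos neg by (simp_all del: add_diff_cancel_left' diff_self)
    with bounds show thesis
      using that by blast
  qed
qed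

theorem proposition4p2:
  fixes \<alpha> :: real and q p :: nat
  assumes "\<alpha> > 0" and "2 * real q - 1 < \<alpha>" and "\<alpha> < 2 * real q + 1"
  shows
    "(\<exists>C C'. C > 0 \<and> C' > 0 \<and>
        (\<forall>h>0. \<forall>k. 0 < \<bar>k\<bar> \<and> \<bar>k\<bar> < pi / h \<longrightarrow>
           cmod (psi \<alpha> q p h k) \<le> C * \<bar>k\<bar> powr \<alpha> \<and>
           psi \<alpha> q p h differentiable (at k) \<and>
           cmod (vector_derivative (psi \<alpha> q p h) (at k)) \<le> C' * \<bar>k\<bar> powr (\<alpha> - 1)))
     \<and> (\<forall>h>0. \<not> changes_sign (\<lambda>k. Re (psi \<alpha> q p h k)) \<longleftrightarrow> \<bar>real p - \<alpha> / 2\<bar> < 1 / 2)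
     \<and> (\<bar>real p - \<alpha> / 2\<bar> < 1 / 2 \<longleftrightarrow>
          (\<exists>c>0. \<forall>h>0. \<forall>k. \<bar>k\<bar> \<le> pi / h \<longrightarrow>
             Re (psi \<alpha> q p h k) \<le> - c * \<bar>k\<bar> powr \<alpha>))"
proof (intro conjI)
  show "\<exists>C C'. C > 0 \<and> C' > 0 \<and>
        (\<forall>h>0. \<forall>k. 0 < \<bar>k\<bar> \<and> \<bar>k\<bar> < pi / h \<longrightarrow>
           cmod (psi \<alpha> q p h k) \<le> C * \<bar>k\<bar> powr \<alpha> \<and>
           psi \<alpha> q p h differentiable (at k) \<and>
           cmod (vector_derivative (psi \<alpha> q p h) (at k)) \<le> C' * \<bar>k\<bar> powr (\<alpha> - 1))"
  proof (rule exI[of _ 1], rule exI[of _ "(2 * real p + \<alpha>) * (1 + (2 / pi) powr (\<alpha> - 1))"],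
      intro conjI allI impI)
    show "(2 * real p + \<alpha>) * (1 + (2 / pi) powr (\<alpha> - 1)) > 0"
      using assms by (intro mult_pos_pos add_nonneg_pos add_pos_nonneg) auto
  qed (use assms cmod_psi_le psi_derivative_bound in auto)
next
  \<comment> \<open>The open interval for \<open>\<alpha>\<close> excludes distance exactly \<open>1/2\<close>: every integer at distance at most \<open>1/2\<close> from \<open>\<alpha>/2\<close> is \<open>q\<close>.\<close>
  have near: "\<bar>real q - \<alpha> / 2\<bar> < 1 / 2"
    using assms by (auto simp: abs_if)
  have far: "\<bar>real p - \<alpha> / 2\<bar> > 1 / 2" if "p \<noteq> q"
  proof -
    have "\<bar>real p - real q\<bar> \<ge> 1"
      using that by linarith
    then show ?thesis
      using near by linarith
  qed
  have near_iff: "\<bar>real p - \<alpha> / 2\<bar> < 1 / 2 \<longleftrightarrow> p = q"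
    using near far by fastforce
  show "\<forall>h>0. \<not> changes_sign (\<lambda>k. Re (psi \<alpha> q p h k)) \<longleftrightarrow> \<bar>real p - \<alpha> / 2\<bar> < 1 / 2"
  proof (intro allI impI iffI)
    fix h :: real
    assume "h > 0" and "\<not> changes_sign (\<lambda>k. Re (psi \<alpha> q p h k))"
    then show "\<bar>real p - \<alpha> / 2\<bar> < 1 / 2"
      unfolding near_iff using far by (metis Re_psi_both_signs changes_sign_def)
  next
    fix h :: real
    assume "\<bar>real p - \<alpha> / 2\<bar> < 1 / 2"
    then have "p = q"
      by (simp only: near_iff)
    then show "\<not> changes_sign (\<lambda>k. Re (psi \<alpha> q p h k))"
      using Re_psi_nonpos[OF near] by (auto simp: changes_sign_def not_less)
  qed
  show "\<bar>real p - \<alpha> / 2\<bar> < 1 / 2 \<longleftrightarrow>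
          (\<exists>c>0. \<forall>h>0. \<forall>k. \<bar>k\<bar> \<le> pi / h \<longrightarrow>
             Re (psi \<alpha> q p h k) \<le> - c * \<bar>k\<bar> powr \<alpha>)"
  proof
    assume "\<bar>real p - \<alpha> / 2\<bar> < 1 / 2"
    then have [simp]: "p = q"
      by (simp only: near_iff)
    have "\<bar>\<alpha> / 2 - real q\<bar> < 1 / 2"
      using near by (simp add: abs_minus_commute)
    then have "(2 / pi) powr \<alpha> * cos ((\<alpha> / 2 - real q) * pi) > 0"
      using cos_scaled_pos(1)[of "\<alpha> / 2 - real q" 0] by simp
    then show "\<exists>c>0. \<forall>h>0. \<forall>k. \<bar>k\<bar> \<le> pi / h \<longrightarrow> Re (psi \<alpha> q p h k) \<le> - c * \<bar>k\<bar> powr \<alpha>"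
      using Re_psi_coercive[OF assms(1) near] by auto
  next
    assume "\<exists>c>0. \<forall>h>0. \<forall>k. \<bar>k\<bar> \<le> pi / h \<longrightarrow> Re (psi \<alpha> q p h k) \<le> - c * \<bar>k\<bar> powr \<alpha>"
    then obtain c where c: "c > 0" and bound:
        "\<And>h k. h > 0 \<Longrightarrow> \<bar>k\<bar> \<le> pi / h \<Longrightarrow> Re (psi \<alpha> q p h k) \<le> - c * \<bar>k\<bar> powr \<alpha>"
      by blast
    show "\<bar>real p - \<alpha> / 2\<bar> < 1 / 2"
    proof (rule ccontr)
      assume "\<not> \<bar>real p - \<alpha> / 2\<bar> < 1 / 2"
      then have "\<bar>real p - \<alpha> / 2\<bar> > 1 / 2"
        using far near_iff by blast
      then obtain k where "0 < k" "k \<le> pi / 1" "Re (psi \<alpha> q p 1 k) > 0"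
        using Re_psi_both_signs[of 1 p \<alpha> q] by (metis zero_less_one)
      moreover from this have "Re (psi \<alpha> q p 1 k) \<le> - c * \<bar>k\<bar> powr \<alpha>"
        by (intro bound) auto
      moreover have "- c * \<bar>k\<bar> powr \<alpha> \<le> 0"
        using c by simp
      ultimately show False
        by linarith
    qed
  qed
qed

end
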